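(* Let $d\mu(x)$ be a scalar measure with monic orthogonal polynomials $\{p_k(x)\}_{k\ge0}$ and three term recurrence coefficients $J_{k,k}$, $J_{k,k-1}$, let $A\in\mathbb{R}^{q\times q}$, and let $\hat P_k(x)\in\mathbb{R}^{2q\times2q}[x]$ be the monic matrix orthogonal polynomials with respect to $W(x)d\mu(x)$, where $W(x)=\mathcal W(x)\mathcal W(x)^\top=\begin{bmatrix} I_q+AA^\top x^2 & Ax \\ A^\top x & I_q \end{bmatrix}$, $\mathcal W(x)=\begin{bmatrix} I_q & Ax \\ 0 & I_q \end{bmatrix}$. Then: 1. The matrices $\rho_{k+1}:=\left(I_q+J_{k+1,k}A^\top A\right)^{-1}$ exist for $k\in\{-1,0,1,\dots\}$. 2. For $k\in\{-1,0,1,\dots\}$, $$\hat P_{k+1}(x)\mathcal W(x)=-\begin{bmatrix} J_{k+1,k}J_{k+1,k+1}A\rho_{k+1}A^\top & 0 \\ J_{k+1,k}\rho_{k+1}A^\top & 0 \end{bmatrix}p_k(x)+\begin{bmatrix} I_q & J_{k+1,k+1}A\rho_{k+1} \\ 0 & \rho_{k+1} \end{bmatrix}p_{k+1}(x)+\begin{bmatrix} 0 & A \\ 0 & 0 \end{bmatrix}p_{k+2}(x).$$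
   Context: The scalar Borel measure $d\mu$ on $\mathbb{R}$ has finite moments and monic orthogonal polynomials $p_k$, $\int p_kp_j\,d\mu=h_k\delta_{k,j}$ with $h_k\neq 0$, satisfying $xp_k(x)=J_{k,k-1}p_{k-1}(x)+J_{k,k}p_k(x)+p_{k+1}(x)$, with $J_{k,k-1}=h_k/h_{k-1}>0$ for $k\ge1$; conventions $p_{-1}=0$, $J_{0,-1}=0$. The monic matrix orthogonal polynomials $\hat P_k$ ($\deg\hat P_k=k$, leading coefficient $I_{2q}$) are determined by $\int\hat P_k(x)W(x)\hat P_j(x)^\top d\mu(x)=\delta_{k,j}\hat H_k$ with nonsingular $\hat H_k\in\mathbb{R}^{2q\times 2q}$. *)

theory Defs
  imports "HOL-Analysis.Analysis" "HOL-Computational_Algebra.Polynomial"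
begin

section \<open>The scalar measure and its orthogonal polynomials\<close>

definition borel_with_moments :: "real measure \<Rightarrow> bool" where
  "borel_with_moments M \<longleftrightarrow>
     sets M = sets borel \<and> (\<forall>n::nat. integrable M (\<lambda>x. x ^ n))"

text \<open>
  All sequences are indexed by integers, so that the index \<open>-1\<close> and the conventions
  attached to it can be written literally. Their values at smaller indices are
  unconstrained and never used.
\<close>

definition monic_orthogonal_polys :: "real measure \<Rightarrow> (int \<Rightarrow> real poly) \<Rightarrow> bool" where
  "monic_orthogonal_polys M p \<longleftrightarrow>
     p (-1) = 0 \<and>
     (\<forall>k\<ge>0. degree (p k) = nat k \<and> lead_coeff (p k) = 1) \<and>
     (\<exists>h::int \<Rightarrow> real. \<forall>k\<ge>0. h k \<noteq> 0 \<and>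
        (\<forall>j\<ge>0. (\<integral>x. poly (p k) x * poly (p j) x \<partial>M) = (if k = j then h k else 0)))"

text \<open>
  For monic orthogonal polynomials these equations determine the coefficients. The relation
  \<open>J k (k - 1) = h k / h (k - 1) > 0\<close> for \<open>k \<ge> 1\<close> is a consequence of them together with
  orthogonality, and is not assumed.
\<close>

definition three_term_recurrence :: "(int \<Rightarrow> real poly) \<Rightarrow> (int \<Rightarrow> int \<Rightarrow> real) \<Rightarrow> bool" where
  "three_term_recurrence p J \<longleftrightarrow>
     J 0 (-1) = 0 \<and>
     (\<forall>k\<ge>0. [:0, 1:] * p k =
        smult (J k (k - 1)) (p (k - 1)) + smult (J k k) (p k) + p (k + 1))"

section \<open>Matrix polynomials and matrix orthogonality\<close>

text \<open>
  A matrix polynomial is represented as a matrix with polynomial entries. The type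
  \<open>(real ^ 'n ^ 'n) poly\<close> is unsuitable, since the ring multiplication of that coefficient
  type is componentwise.
\<close>

definition eval_mat :: "real poly ^ 'n ^ 'm \<Rightarrow> real \<Rightarrow> real ^ 'n ^ 'm" where
  "eval_mat P x = (\<chi> i j. poly (P $ i $ j) x)"

definition coeff_mat :: "real poly ^ 'n ^ 'm \<Rightarrow> nat \<Rightarrow> real ^ 'n ^ 'm" where
  "coeff_mat P n = (\<chi> i j. coeff (P $ i $ j) n)"

definition monic_of_degree :: "nat \<Rightarrow> real poly ^ 'n ^ 'n \<Rightarrow> bool" where
  "monic_of_degree n P \<longleftrightarrow> coeff_mat P n = mat 1 \<and> (\<forall>m>n. coeff_mat P m = 0)"

definition monic_matrix_orthogonal_polys ::
  "real measure \<Rightarrow> (real \<Rightarrow> real ^ 'n ^ 'n) \<Rightarrow> (int \<Rightarrow> real poly ^ 'n ^ 'n) \<Rightarrow> bool" where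
  "monic_matrix_orthogonal_polys M W P \<longleftrightarrow>
     (\<forall>k\<ge>0. monic_of_degree (nat k) (P k)) \<and>
     (\<exists>H::int \<Rightarrow> real ^ 'n ^ 'n. \<forall>k\<ge>0. invertible (H k) \<and>
        (\<forall>j\<ge>0. (\<integral>x. eval_mat (P k) x ** W x ** transpose (eval_mat (P j) x) \<partial>M) =
          (if k = j then H k else 0)))"

section \<open>The weight\<close>

text \<open>
  Matrices of size \<open>2q\<close> have index type \<open>'q + 'q\<close> with \<open>q = CARD('q)\<close>.
\<close>

definition block ::
  "real ^ 'q ^ 'q \<Rightarrow> real ^ 'q ^ 'q \<Rightarrow> real ^ 'q ^ 'q \<Rightarrow> real ^ 'q ^ 'q
     \<Rightarrow> real ^ ('q + 'q) ^ ('q + 'q)" where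
  "block A B C D = (\<chi> i j. case i of
      Inl a \<Rightarrow> (case j of Inl b \<Rightarrow> A $ a $ b | Inr b \<Rightarrow> B $ a $ b)
    | Inr a \<Rightarrow> (case j of Inl b \<Rightarrow> C $ a $ b | Inr b \<Rightarrow> D $ a $ b))"

definition weight_factor :: "real ^ 'q ^ 'q \<Rightarrow> real \<Rightarrow> real ^ ('q + 'q) ^ ('q + 'q)" where
  "weight_factor A x = block (mat 1) (x *\<^sub>R A) 0 (mat 1)"

definition weight :: "real ^ 'q ^ 'q \<Rightarrow> real \<Rightarrow> real ^ ('q + 'q) ^ ('q + 'q)" where
  "weight A x = weight_factor A x ** transpose (weight_factor A x)"

definition rho :: "(int \<Rightarrow> int \<Rightarrow> real) \<Rightarrow> real ^ 'q ^ 'q \<Rightarrow> int \<Rightarrow> real ^ 'q ^ 'q" where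
  "rho J A n = matrix_inv (mat 1 + J n (n - 1) *\<^sub>R (transpose A ** A))"

lemma transpose_block:
  "transpose (block A B C D) =
     block (transpose A) (transpose C) (transpose B) (transpose D)"
  by (simp add: block_def transpose_def vec_eq_iff split: sum.split)

lemma block_mult:
  "block A B C D ** block A' B' C' D' =
     block (A ** A' + B ** C') (A ** B' + B ** D') (C ** A' + D ** C') (C ** B' + D ** D')"
proof -
  have "(\<Sum>k\<in>UNIV. f k) = (\<Sum>k\<in>UNIV. f (Inl k)) + (\<Sum>k\<in>UNIV. f (Inr k))"
    for f :: "'a + 'a \<Rightarrow> real"
    by (simp add: sum.Plus comp_def flip: UNIV_Plus_UNIV)
  then show ?thesis
    by (simp add: block_def matrix_matrix_mult_def vec_eq_iff split: sum.split)
qed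

lemma weight_eq_block:
  "weight A x =
     block (mat 1 + x\<^sup>2 *\<^sub>R (A ** transpose A)) (x *\<^sub>R A) (x *\<^sub>R transpose A) (mat 1)"
proof -
  have "transpose (0 :: real ^ 'a ^ 'a) = 0" "transpose (x *\<^sub>R A) = x *\<^sub>R transpose A"
    "(x *\<^sub>R A) ** (x *\<^sub>R transpose A) = x\<^sup>2 *\<^sub>R (A ** transpose A)"
    by (simp_all add: transpose_def vec_eq_iff matrix_matrix_mult_def power2_eq_square
        sum_distrib_left algebra_simps)
  then show ?thesis
    by (simp add: weight_def weight_factor_def transpose_block block_mult)
qed

end

theory Submission
  imports Defs
begin

text \<open>
  The rows of the claimed right-hand side are orthogonal to \<open>v \<W>\<close> for every row \<open>v\<close> of
  polynomials of degree below \<open>n = k + 1\<close>: since \<open>v \<W> = (v\<^sub>1, x v\<^sub>1 A + v\<^sub>2)\<close>, the only surviving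
  terms are multiples of \<open>L (p\<^bsub>n-1\<^esub> v\<^sub>1)\<close> and \<open>L (x p\<^sub>n v\<^sub>1) = J\<^bsub>n,n-1\<^esub> L (p\<^bsub>n-1\<^esub> v\<^sub>1)\<close>, and they cancel.
  Multiplying by \<open>\<W>\<^sup>-\<^sup>1\<close> gives polynomial rows which are monic of degree \<open>n\<close>, precisely because
  \<open>\<rho>\<^sub>n (I + J\<^bsub>n,n-1\<^esub> A\<^sup>T A) = I\<close>. The rows of \<open>P\<^sub>n \<W>\<close> have both properties as well, so the difference
  is orthogonal to itself and vanishes, \<open>d\<mu>\<close> being positive definite on polynomials.
\<close>

section \<open>Scalar orthogonal polynomials\<close>

text \<open>The bound is an integer and the condition is on coefficients, so that bound 0 means the
  zero polynomial, which \<open>degree\<close> cannot separate from a constant. This makes the index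
  -1 and the base cases of the inductions uniform.\<close>

definition degree_less :: "int \<Rightarrow> real poly \<Rightarrow> bool" where
  "degree_less n f \<longleftrightarrow> (\<forall>m. n \<le> int m \<longrightarrow> coeff f m = 0)"

lemma degree_less_add: "degree_less n f \<Longrightarrow> degree_less n g \<Longrightarrow> degree_less n (f + g)"
  by (simp add: degree_less_def)

lemma degree_less_diff: "degree_less n f \<Longrightarrow> degree_less n g \<Longrightarrow> degree_less n (f - g)"
  by (simp add: degree_less_def)

lemma degree_less_smult: "degree_less n f \<Longrightarrow> degree_less n (smult c f)"
  by (simp add: degree_less_def)

lemma degree_less_mono: "degree_less m f \<Longrightarrow> m \<le> n \<Longrightarrow> degree_less n f"
  by (auto simp: degree_less_def)

lemma degree_less_times_X: "degree_less n f \<Longrightarrow> degree_less (n + 1) ([:0, 1:] * f)"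
  by (auto simp: degree_less_def coeff_pCons split: nat.split)

lemma degree_less_step:
  assumes "degree_less (int n + 1) f" "coeff f n = 0"
  shows "degree_less (int n) f"
  unfolding degree_less_def
proof (intro allI impI)
  fix m assume "int n \<le> int m"
  then show "coeff f m = 0"
    using assms by (cases "m = n") (auto simp: degree_less_def)
qed

lemma degree_less_0: "degree_less 0 f \<longleftrightarrow> f = 0"
  by (auto simp: degree_less_def poly_eq_iff)

text \<open>Abstracts integration of polynomials against the measure. Definiteness is not part of
  the abstraction: it is derived from the nonzero norms \<open>h k\<close>.\<close>

locale positive_functional =
  fixes L :: "real poly \<Rightarrow> real"
  assumes add: "L (f + g) = L f + L g"
    and smult: "L (smult c f) = c * L f"
    and square_nonneg: "0 \<le> L (f * f)"
begin

lemma zero: "L 0 = 0"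
  using smult[of 0 0] by simp

lemma minus: "L (- f) = - L f"
  using smult[of "- 1" f] by simp

lemma diff: "L (f - g) = L f - L g"
  using add[of f "- g"] by (simp add: minus)

lemma sum: "L (\<Sum>i\<in>I. f i) = (\<Sum>i\<in>I. L (f i))"
  by (induction I rule: infinite_finite_induct) (simp_all add: zero add)

lemmas linear = add diff minus smult sum zero

end

locale orthogonal_sequence = positive_functional +
  fixes p :: "int \<Rightarrow> real poly" and h :: "int \<Rightarrow> real" and J :: "int \<Rightarrow> int \<Rightarrow> real"
  assumes p_neg: "p (-1) = 0"
    and p_degree: "0 \<le> k \<Longrightarrow> degree_less (k + 1) (p k)"
    and p_monic: "0 \<le> k \<Longrightarrow> coeff (p k) (nat k) = 1"
    and h_nonzero: "0 \<le> k \<Longrightarrow> h k \<noteq> 0"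
    and orthogonal: "0 \<le> k \<Longrightarrow> 0 \<le> j \<Longrightarrow> L (p k * p j) = (if k = j then h k else 0)"
    and J_0: "J 0 (-1) = 0"
    and recurrence: "0 \<le> k \<Longrightarrow>
      [:0, 1:] * p k = smult (J k (k - 1)) (p (k - 1)) + smult (J k k) (p k) + p (k + 1)"
begin

lemma p_degree': "-1 \<le> k \<Longrightarrow> degree_less (k + 1) (p k)"
  using p_degree[of k] p_neg by (cases "k = -1") (auto simp: degree_less_0)

lemma h_pos: "0 \<le> k \<Longrightarrow> 0 < h k"
  using orthogonal[of k k] square_nonneg[of "p k"] h_nonzero[of k] by simp

text \<open>Induction on the degree bound: subtracting the multiple of the monic \<open>p n\<close>
  with the same top coefficient lowers the degree, and the subtracted term is orthogonal to
  \<open>p k\<close>.\<close>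

lemma orthogonal_degree_less:
  assumes "degree_less k v" "0 \<le> k"
  shows "L (p k * v) = 0"
proof -
  have "L (p k * v) = 0" if "degree_less (int n) v" "int n \<le> k" for n v
    using that
  proof (induction n arbitrary: v)
    case 0
    then show ?case by (simp add: degree_less_0 zero)
  next
    case (Suc n)
    define w where "w = v - smult (coeff v n) (p (int n))"
    have "degree_less (int n + 1) w"
      unfolding w_def using Suc.prems p_degree[of "int n"]
      by (intro degree_less_diff degree_less_smult) (simp_all add: add.commute)
    moreover have "coeff w n = 0"
      using p_monic[of "int n"] by (simp add: w_def)
    ultimately have "L (p k * w) = 0"
      using Suc by (intro Suc.IH degree_less_step) simp_all
    moreover have "L (p k * p (int n)) = 0"
      using Suc.prems orthogonal[of k "int n"] by simp
    moreover have "p k * v = p k * w + smult (coeff v n) (p k * p (int n))"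
      by (simp add: w_def algebra_simps)
    ultimately show ?case by (simp add: linear)
  qed
  from this[of "nat k" v] show ?thesis using assms by simp
qed

text \<open>Split off the top term, f = c p_d + g with deg g < d. The cross terms vanish by
  orthogonality, so L(f f) = c^2 h_d + L(g g), where the first summand is positive and the second
  nonnegative.\<close>

lemma definite:
  assumes "L (f * f) = 0"
  shows "f = 0"
proof (rule ccontr)
  assume "f \<noteq> 0"
  define d c where "d = int (degree f)" and "c = lead_coeff f"
  define g where "g = f - smult c (p d)"
  have "0 \<le> d" by (simp add: d_def)
  have "degree_less (d + 1) g"
    unfolding g_def
  proof (intro degree_less_diff degree_less_smult p_degree)
    show "degree_less (d + 1) f"
      by (auto simp: d_def degree_less_def intro!: coeff_eq_0)
  qed (simp add: d_def)
  then have "degree_less d g"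
    using p_monic[of d] unfolding d_def by (intro degree_less_step) (simp_all add: g_def c_def d_def)
  then have pg: "L (p d * g) = 0"
    by (intro orthogonal_degree_less) (simp_all add: d_def)
  have f_square: "f * f = smult (c\<^sup>2) (p d * p d) + smult c (p d * g) + smult c (p d * g) + g * g"
  proof -
    have f: "f = smult c (p d) + g" by (simp add: g_def)
    show ?thesis
      unfolding f by (simp add: distrib_left distrib_right smult_add_right power2_eq_square mult.commute)
  qed
  have "L (f * f) = c\<^sup>2 * L (p d * p d) + c * L (p d * g) + c * L (p d * g) + L (g * g)"
    by (simp only: f_square linear)
  also have "\<dots> = c\<^sup>2 * h d + L (g * g)"
    using orthogonal[of d d] by (simp add: pg \<open>0 \<le> d\<close>)
  finally have "L (f * f) = c\<^sup>2 * h d + L (g * g)" .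
  moreover have "0 < c\<^sup>2 * h d"
    using \<open>f \<noteq> 0\<close> h_pos[of d] by (simp add: c_def d_def)
  ultimately show False
    using assms square_nonneg[of g] by simp
qed

text \<open>For n > 0, computing L(x p_n p_{n-1}) with the recurrence at n - 1 gives h_n, and with
  the recurrence at n it gives J_{n,n-1} h_{n-1}. At n = 0 the convention makes the coefficient
  0.\<close>

lemma J_subdiagonal_nonneg:
  assumes "0 \<le> n"
  shows "0 \<le> J n (n - 1)"
proof (cases "n = 0")
  case True
  then show ?thesis by (simp add: J_0)
next
  case False
  have "[:0, 1:] * p n * p (n - 1) = ([:0, 1:] * p (n - 1)) * p n"
    by (simp add: algebra_simps)
  also have "\<dots> = (smult (J (n - 1) (n - 1 - 1)) (p (n - 1 - 1)) +
      smult (J (n - 1) (n - 1)) (p (n - 1)) + p n) * p n"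
    using recurrence[of "n - 1"] assms False by simp
  finally have "L ([:0, 1:] * p n * p (n - 1)) =
      J (n - 1) (n - 1 - 1) * L (p n * p (n - 1 - 1)) +
      J (n - 1) (n - 1) * L (p n * p (n - 1)) + L (p n * p n)"
    by (simp add: linear algebra_simps)
  \<comment> \<open>For n = 1 the second factor is \<open>p (-1) = 0\<close>, outside the range of
    \<open>orthogonal\<close>; the degree bound covers this case too.\<close>
  also have "L (p n * p (n - 1 - 1)) = 0"
    using assms False by (intro orthogonal_degree_less degree_less_mono[OF p_degree']) simp_all
  also have "L (p n * p (n - 1)) = 0"
    using orthogonal[of n "n - 1"] assms False by simp
  also have "L (p n * p n) = h n"
    using orthogonal[of n n] assms by simp
  also have "L ([:0, 1:] * p n * p (n - 1)) = J n (n - 1) * h (n - 1)"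
  proof -
    have "L ([:0, 1:] * p n * p (n - 1)) =
      J n (n - 1) * L (p (n - 1) * p (n - 1)) + J n n * L (p n * p (n - 1)) + L (p (n + 1) * p (n - 1))"
      unfolding recurrence[OF assms] by (simp add: linear algebra_simps)
    then show ?thesis
      using assms False orthogonal[of "n - 1" "n - 1"] orthogonal[of n "n - 1"]
        orthogonal[of "n + 1" "n - 1"] by simp
  qed
  finally have "J n (n - 1) * h (n - 1) = h n" by simp
  then have "J n (n - 1) = h n / h (n - 1)"
    using h_nonzero[of "n - 1"] assms False by (simp add: field_simps)
  then show ?thesis
    using h_pos[of n] h_pos[of "n - 1"] assms False by (simp add: less_imp_le)
qed

end

section \<open>Rows of polynomials\<close>

lemma sum_Plus_UNIV:
  fixes f :: "'a::finite + 'b::finite \<Rightarrow> 'c::comm_monoid_add"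
  shows "(\<Sum>k\<in>UNIV. f k) = (\<Sum>k\<in>UNIV. f (Inl k)) + (\<Sum>k\<in>UNIV. f (Inr k))"
  by (simp add: sum.Plus comp_def flip: UNIV_Plus_UNIV)

definition row_degree_less :: "int \<Rightarrow> real poly ^ 'm \<Rightarrow> bool" where
  "row_degree_less n v \<longleftrightarrow> (\<forall>j. degree_less n (v $ j))"

text \<open>The product of a row of polynomials with \<^const>\<open>weight_factor\<close>.\<close>

definition shear :: "real ^ 'q ^ 'q \<Rightarrow> real poly ^ ('q + 'q) \<Rightarrow> real poly ^ ('q + 'q)" where
  "shear A v = (\<chi> j. case j of Inl b \<Rightarrow> v $ Inl b
     | Inr b \<Rightarrow> v $ Inr b + [:0, 1:] * (\<Sum>c\<in>UNIV. smult (A $ c $ b) (v $ Inl c)))"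

lemma shear_Inl [simp]: "shear A v $ Inl b = v $ Inl b"
  by (simp add: shear_def)

lemma shear_Inr [simp]:
  "shear A v $ Inr b = v $ Inr b + [:0, 1:] * (\<Sum>c\<in>UNIV. smult (A $ c $ b) (v $ Inl c))"
  by (simp add: shear_def)

lemma vec_eq_iff_Plus:
  "v = w \<longleftrightarrow> (\<forall>b. v $ Inl b = w $ Inl b) \<and> (\<forall>b. v $ Inr b = w $ Inr b)"
  for v w :: "'a ^ ('m::finite + 'n::finite)"
  by (metis sum.exhaust vec_eq_iff)

lemma smult_sum_right: "smult c (\<Sum>i\<in>I. f i) = (\<Sum>i\<in>I. smult c (f i))"
  for f :: "'b \<Rightarrow> 'a::comm_semiring_0 poly"
  by (induction I rule: infinite_finite_induct) (simp_all add: smult_add_right)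

lemma shear_diff: "shear A (v - w) = shear A v - shear A w"
  by (simp add: vec_eq_iff_Plus smult_diff_right sum_subtractf algebra_simps)

lemma shear_add: "shear A (v + w) = shear A v + shear A w"
  by (simp add: vec_eq_iff_Plus smult_add_right sum.distrib algebra_simps)

lemma shear_smult: "shear A (\<chi> j. smult c (v $ j)) = (\<chi> j. smult c (shear A v $ j))"
  by (simp add: vec_eq_iff_Plus smult_sum_right smult_add_right mult.commute)

lemma shear_0 [simp]: "shear A 0 = 0"
  by (simp add: vec_eq_iff_Plus)

lemma shear_sum: "shear A (\<Sum>i\<in>I. v i) = (\<Sum>i\<in>I. shear A (v i))"
  by (induction I rule: infinite_finite_induct) (simp_all add: shear_add)

text \<open>Links the algebra of polynomial rows to the evaluated matrices of the theorem: row i of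
  the product with the weight factor is again a polynomial row.\<close>

lemma poly_shear:
  "(eval_mat P x ** weight_factor A x) $ i $ j = poly (shear A (P $ i) $ j) x"
  by (cases j) (simp_all add: matrix_matrix_mult_def eval_mat_def weight_factor_def block_def
      sum_Plus_UNIV mat_def if_distrib poly_sum sum_distrib_left mult_ac cong: if_cong)

section \<open>The pairing of polynomial rows\<close>

context positive_functional
begin

text \<open>Since the weight is the factor times its transpose, pairing the sheared rows of v and w
  amounts to integrating v W w^T. The weight thus disappears into \<open>shear\<close>.\<close>

definition ip :: "real poly ^ 'm \<Rightarrow> real poly ^ 'm \<Rightarrow> real" where
  "ip v w = (\<Sum>j\<in>UNIV. L (v $ j * w $ j))"

lemma ip_diff_left: "ip (u - v) w = ip u w - ip v w"
  by (simp add: ip_def algebra_simps linear sum_subtractf)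

lemma ip_add_right: "ip w (u + v) = ip w u + ip w v"
  by (simp add: ip_def algebra_simps linear sum.distrib)

lemma ip_smult_right: "ip w (\<chi> j. smult c (v $ j)) = c * ip w v"
  by (simp add: ip_def linear sum_distrib_left)

lemma ip_0_right [simp]: "ip w 0 = 0"
  by (simp add: ip_def linear)

lemma ip_sum_right: "ip w (\<Sum>i\<in>I. v i) = (\<Sum>i\<in>I. ip w (v i))"
  by (induction I rule: infinite_finite_induct) (simp_all add: ip_add_right)

lemma ip_Plus:
  "ip v w = (\<Sum>b\<in>UNIV. L (v $ Inl b * w $ Inl b)) + (\<Sum>b\<in>UNIV. L (v $ Inr b * w $ Inr b))"
  by (simp add: ip_def sum_Plus_UNIV)

text \<open>The matrix analogue of \<open>orthogonal_degree_less\<close>: the rows of the monic P_n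
  have the unit vectors as coefficients of x^n, so they can cancel any top coefficient row.\<close>

lemma matrix_orthogonal_degree_less:
  fixes P :: "int \<Rightarrow> real poly ^ ('q::finite + 'q) ^ ('q + 'q)"
  assumes monic: "\<And>k. 0 \<le> k \<Longrightarrow> monic_of_degree (nat k) (P k)"
    and orth: "\<And>k j i l. 0 \<le> k \<Longrightarrow> 0 \<le> j \<Longrightarrow> k \<noteq> j \<Longrightarrow>
      ip (shear A (P k $ i)) (shear A (P j $ l)) = 0"
    and v: "row_degree_less k v" and k: "0 \<le> k"
  shows "ip (shear A (P k $ i)) (shear A v) = 0"
proof -
  have "ip (shear A (P k $ i)) (shear A v) = 0" if "row_degree_less (int n) v" "int n \<le> k" for n v
    using that
  proof (induction n arbitrary: v)
    case 0
    then have "v = 0"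
      by (simp add: row_degree_less_def degree_less_0 vec_eq_iff)
    then show ?case by simp
  next
    case (Suc n)
    \<comment> \<open>The combination of rows of P_n whose x^n coefficient row equals that of
      v.\<close>
    define u where "u = (\<Sum>l\<in>UNIV. \<chi> j. smult (coeff (v $ l) n) (P (int n) $ l $ j))"
    have coeff_P: "coeff (P (int n) $ l $ j) m = (if m = n \<and> l = j then 1 else 0)" if "n \<le> m" for l j m
      using monic[of "int n"] that
      by (cases "m = n") (auto simp: monic_of_degree_def coeff_mat_def vec_eq_iff mat_def)
    have "row_degree_less (int n) (v - u)"
      unfolding row_degree_less_def
    proof
      fix j
      have "degree_less (int n + 1) ((v - u) $ j)"
        using Suc.prems coeff_P
        by (auto simp: u_def degree_less_def row_degree_less_def coeff_sum)
      moreover have "coeff ((v - u) $ j) n = 0"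
        by (simp add: u_def coeff_sum coeff_P if_distrib cong: if_cong)
      ultimately show "degree_less (int n) ((v - u) $ j)"
        by (rule degree_less_step)
    qed
    then have "ip (shear A (P k $ i)) (shear A (v - u)) = 0"
      using Suc by simp
    moreover have "ip (shear A (P k $ i)) (shear A u) = 0"
      using Suc.prems k by (simp add: u_def shear_sum ip_sum_right shear_smult ip_smult_right orth)
    ultimately show ?case
      using ip_add_right[of _ "shear A (v - u)" "shear A u"] by (simp add: flip: shear_add)
  qed
  from this[of "nat k" v] show ?thesis using v k by simp
qed

end

section \<open>Candidate rows: orthogonality, monicity and uniqueness\<close>

context orthogonal_sequence
begin

lemma ip_definite:
  assumes "ip v v = 0"
  shows "v = 0"
  using assms definite square_nonneg
  by (auto simp: ip_def sum_nonneg_eq_0_iff vec_eq_iff)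

text \<open>
  A row of the claimed right-hand side is determined by its part \<open>(\<beta>, \<gamma>)\<close> in the coefficient
  of \<open>p\<^sub>n\<close>.
\<close>

definition target_row ::
  "real ^ 'q ^ 'q \<Rightarrow> int \<Rightarrow> real ^ 'q \<Rightarrow> real ^ 'q \<Rightarrow> real poly ^ ('q + 'q)" where
  "target_row A n \<beta> \<gamma> = (\<chi> j. case j of
      Inl b \<Rightarrow> smult (\<beta> $ b) (p n) - smult (J n (n - 1) * (\<gamma> v* transpose A) $ b) (p (n - 1))
    | Inr b \<Rightarrow> smult (\<gamma> $ b) (p n) + smult ((\<beta> v* A) $ b) (p (n + 1)))"

text \<open>The term in p_{n-1} of the first half contributes -J_{n,n-1} (\<gamma> A^T) paired with
  \<phi>. The second half contributes the same with opposite sign, because x p_n acts on the first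
  half of v as J_{n,n-1} p_{n-1}.\<close>

lemma target_row_orthogonal:
  fixes A :: "real ^ 'q ^ 'q"
  assumes n: "0 \<le> n" and v: "row_degree_less n v"
  shows "ip (target_row A n \<beta> \<gamma>) (shear A v) = 0"
proof -
  define \<phi> where "\<phi> c = L (p (n - 1) * v $ Inl c)" for c
  have deg: "degree_less n (v $ j)" for j
    using v by (simp add: row_degree_less_def)
  have pn: "L (p n * v $ j) = 0" for j
    by (rule orthogonal_degree_less[OF deg n])
  have pn1: "L (p (n + 1) * v $ j) = 0" for j
    by (rule orthogonal_degree_less[OF degree_less_mono[OF deg]]) (use n in simp_all)
  \<comment> \<open>Multiplication by x raises the degree bound only to n + 1, which
    \<open>p (n + 1)\<close> still annihilates. Against \<open>p n\<close> the same factor leaves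
    the trace computed next.\<close>
  have pn1_X: "L (p (n + 1) * ([:0, 1:] * v $ j)) = 0" for j
    by (rule orthogonal_degree_less[OF degree_less_times_X[OF deg]]) (use n in simp)
  have Xpn: "L (p n * ([:0, 1:] * v $ Inl c)) = J n (n - 1) * \<phi> c" for c
  proof -
    have "p n * ([:0, 1:] * v $ Inl c) = ([:0, 1:] * p n) * v $ Inl c"
      by (simp only: mult_ac)
    then show ?thesis
      by (simp only: recurrence[OF n]) (simp add: distrib_right linear pn pn1 \<phi>_def)
  qed
  have L_shear: "L (q * shear A v $ Inr b) =
      L (q * v $ Inr b) + (\<Sum>c\<in>UNIV. A $ c $ b * L (q * ([:0, 1:] * v $ Inl c)))" for q b
  proof -
    have "q * shear A v $ Inr b =
        q * v $ Inr b + (\<Sum>c\<in>UNIV. smult (A $ c $ b) (q * ([:0, 1:] * v $ Inl c)))"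
      by (simp only: shear_Inr distrib_left sum_distrib_left mult_smult_right)
    then show ?thesis by (simp only: linear)
  qed
  have "ip (target_row A n \<beta> \<gamma>) (shear A v) =
      (\<Sum>b\<in>UNIV. - (J n (n - 1) * (\<gamma> v* transpose A) $ b * \<phi> b)) +
      (\<Sum>b\<in>UNIV. \<gamma> $ b * (\<Sum>c\<in>UNIV. A $ c $ b * (J n (n - 1) * \<phi> c)))"
    unfolding ip_Plus
  proof (intro arg_cong2[where f = "(+)"] sum.cong refl)
    fix b
    show "L (target_row A n \<beta> \<gamma> $ Inl b * shear A v $ Inl b) =
        - (J n (n - 1) * (\<gamma> v* transpose A) $ b * \<phi> b)"
      by (simp add: target_row_def left_diff_distrib linear pn \<phi>_def)
    show "L (target_row A n \<beta> \<gamma> $ Inr b * shear A v $ Inr b) =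
        \<gamma> $ b * (\<Sum>c\<in>UNIV. A $ c $ b * (J n (n - 1) * \<phi> c))"
      by (simp add: target_row_def distrib_right linear L_shear pn pn1 pn1_X Xpn
          del: shear_Inr mult_pCons_left mult_pCons_right)
  qed
  \<comment> \<open>Exchanging the sums collects \<gamma> and A into \<gamma> A^T, so that the two
    contributions cancel.\<close>
  also have "(\<Sum>b\<in>UNIV. \<gamma> $ b * (\<Sum>c\<in>UNIV. A $ c $ b * (J n (n - 1) * \<phi> c))) =
      (\<Sum>c\<in>UNIV. \<Sum>b\<in>UNIV. \<gamma> $ b * (A $ c $ b * (J n (n - 1) * \<phi> c)))"
    unfolding sum_distrib_left by (rule sum.swap)
  also have "\<dots> = (\<Sum>c\<in>UNIV. J n (n - 1) * (\<gamma> v* transpose A) $ c * \<phi> c)"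
    by (simp add: vector_matrix_mult_def transpose_def sum_distrib_left sum_distrib_right mult_ac)
  finally show ?thesis by (simp add: sum_negf)
qed

text \<open>Undoing the shear leaves (\<beta>, \<gamma> (I + J_{n,n-1} A^T A) - J_{n,n} \<beta> A)
  as the coefficient of x^n; \<open>eq\<close> says that its second half is \<epsilon>.\<close>

lemma target_row_monic:
  fixes A :: "real ^ 'q ^ 'q"
  assumes n: "0 \<le> n"
    and eq: "\<gamma> v* (mat 1 + J n (n - 1) *\<^sub>R (transpose A ** A)) = J n n *\<^sub>R (\<beta> v* A) + \<epsilon>"
  obtains w where "shear A w = target_row A n \<beta> \<gamma>" "row_degree_less (n + 1) w"
    "\<And>b. coeff (w $ Inl b) (nat n) = \<beta> $ b" "\<And>b. coeff (w $ Inr b) (nat n) = \<epsilon> $ b"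
proof
  define s where "s = target_row A n \<beta> \<gamma>"
  \<comment> \<open>The row s times the inverse of the weight factor, whose upper right block is -x
    A.\<close>
  define w :: "real poly ^ ('q + 'q)" where "w = (\<chi> j. case j of Inl b \<Rightarrow> s $ Inl b
     | Inr b \<Rightarrow> s $ Inr b - [:0, 1:] * (\<Sum>c\<in>UNIV. smult (A $ c $ b) (s $ Inl c)))"
  define \<alpha> where "\<alpha> = \<gamma> v* transpose A"
  show "shear A w = target_row A n \<beta> \<gamma>"
    by (simp add: vec_eq_iff_Plus w_def s_def)
  have s_Inl: "s $ Inl b = smult (\<beta> $ b) (p n) - smult (J n (n - 1) * \<alpha> $ b) (p (n - 1))" for b
    by (simp add: s_def target_row_def \<alpha>_def)
  have sum_s: "(\<Sum>c\<in>UNIV. smult (A $ c $ b) (s $ Inl c)) =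
      smult ((\<beta> v* A) $ b) (p n) - smult (J n (n - 1) * (\<alpha> v* A) $ b) (p (n - 1))" for b
    by (simp add: s_Inl smult_diff_right sum_subtractf
        vector_matrix_mult_def smult_sum sum_distrib_left mult_ac)
  have w_Inl: "w $ Inl b = smult (\<beta> $ b) (p n) - smult (J n (n - 1) * \<alpha> $ b) (p (n - 1))" for b
    by (simp add: w_def s_Inl)
  \<comment> \<open>The recurrence replaces p_{n+1} - x p_n by terms of degree at most n, so the
    degree n + 1 part cancels.\<close>
  have w_Inr: "w $ Inr b = smult (\<gamma> $ b - (\<beta> v* A) $ b * J n n) (p n)
      - smult ((\<beta> v* A) $ b * J n (n - 1)) (p (n - 1))
      + smult (J n (n - 1) * (\<alpha> v* A) $ b) ([:0, 1:] * p (n - 1))" for b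
  proof -
    have "w $ Inr b = smult (\<gamma> $ b) (p n) + smult ((\<beta> v* A) $ b) (p (n + 1))
        - smult ((\<beta> v* A) $ b) ([:0, 1:] * p n)
        + smult (J n (n - 1) * (\<alpha> v* A) $ b) ([:0, 1:] * p (n - 1))"
      by (simp only: w_def vec_lambda_beta sum.case sum_s right_diff_distrib mult_smult_right)
         (simp add: s_def target_row_def)
    then show ?thesis
      unfolding recurrence[OF n] by (simp add: smult_add_right smult_diff_left algebra_simps)
  qed
  have deg: "degree_less (n + 1) (p n)" "degree_less n (p (n - 1))"
    "degree_less (n + 1) ([:0, 1:] * p (n - 1))"
    using p_degree'[of n] p_degree'[of "n - 1"] degree_less_times_X[of n "p (n - 1)"] n by auto
  show "row_degree_less (n + 1) w"
    unfolding row_degree_less_def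
  proof
    fix j show "degree_less (n + 1) (w $ j)"
      using deg(1,3) degree_less_mono[OF deg(2), of "n + 1"]
      by (cases j) (simp_all only: w_Inl w_Inr degree_less_add degree_less_diff degree_less_smult)
  qed
  have coeff0: "coeff (p (n - 1)) (nat n) = 0"
    using deg(2) n by (simp add: degree_less_def)
  then show "coeff (w $ Inl b) (nat n) = \<beta> $ b" for b
    by (simp add: w_Inl p_monic n)
  \<comment> \<open>The factor \<open>J n (n - 1)\<close> has to stay: at n = 0 the polynomial
    \<open>p (-1)\<close> is zero rather than monic, and the equation holds only because
    \<open>J 0 (-1) = 0\<close>.\<close>
  have X: "J n (n - 1) * coeff ([:0, 1:] * p (n - 1)) (nat n) = J n (n - 1)"
  proof (cases "n = 0")
    case False
    then have "nat n = Suc (nat (n - 1))" using n by simp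
    then show ?thesis using p_monic[of "n - 1"] n False by simp
  qed (simp add: J_0)
  show "coeff (w $ Inr b) (nat n) = \<epsilon> $ b" for b
  proof -
    have "coeff (w $ Inr b) (nat n) = \<gamma> $ b - (\<beta> v* A) $ b * J n n
        + (\<alpha> v* A) $ b * (J n (n - 1) * coeff ([:0, 1:] * p (n - 1)) (nat n))"
      unfolding w_Inr by (simp add: coeff0 p_monic n mult.assoc mult.left_commute del: mult_pCons_left)
    also have "\<dots> = \<gamma> $ b - (\<beta> v* A) $ b * J n n + (\<alpha> v* A) $ b * J n (n - 1)"
      by (simp only: X)
    also have "\<dots> = \<epsilon> $ b"
    proof -
      have "\<gamma> v* (mat 1 + J n (n - 1) *\<^sub>R (transpose A ** A)) = \<gamma> + J n (n - 1) *\<^sub>R (\<alpha> v* A)"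
        unfolding \<alpha>_def vector_matrix_mul_assoc
        by (simp add: vec_eq_iff vector_matrix_mult_def mat_def distrib_left sum.distrib
            if_distrib[where f = "\<lambda>y. _ * y"] sum_distrib_left mult_ac cong: if_cong)
      then have "(\<gamma> + J n (n - 1) *\<^sub>R (\<alpha> v* A)) $ b = (J n n *\<^sub>R (\<beta> v* A) + \<epsilon>) $ b"
        using eq by simp
      then show ?thesis by (simp add: mult.commute)
    qed
    finally show ?thesis .
  qed
qed

text \<open>The row r and the row w behind the target share their x^n coefficient, so r - w has
  degree below n. Both sheared rows are orthogonal to its shear, hence their difference is
  orthogonal to itself.\<close>

lemma shear_eq_target_row:
  fixes A :: "real ^ 'q ^ 'q"
  assumes n: "0 \<le> n"
    and eq: "\<gamma> v* (mat 1 + J n (n - 1) *\<^sub>R (transpose A ** A)) = J n n *\<^sub>R (\<beta> v* A) + \<epsilon>"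
    and r: "row_degree_less (n + 1) r"
      "\<And>b. coeff (r $ Inl b) (nat n) = \<beta> $ b" "\<And>b. coeff (r $ Inr b) (nat n) = \<epsilon> $ b"
    and orth: "\<And>v. row_degree_less n v \<Longrightarrow> ip (shear A r) (shear A v) = 0"
  shows "shear A r = target_row A n \<beta> \<gamma>"
proof -
  obtain w where w: "shear A w = target_row A n \<beta> \<gamma>" "row_degree_less (n + 1) w"
    "\<And>b. coeff (w $ Inl b) (nat n) = \<beta> $ b" "\<And>b. coeff (w $ Inr b) (nat n) = \<epsilon> $ b"
    using target_row_monic[OF n eq] by blast
  have low: "row_degree_less n (r - w)"
    unfolding row_degree_less_def
  proof
    fix j
    have "degree_less (int (nat n) + 1) ((r - w) $ j)"
      using r(1) w(2) n by (simp add: row_degree_less_def degree_less_diff)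
    moreover have "coeff ((r - w) $ j) (nat n) = 0"
      using r w by (cases j) simp_all
    ultimately show "degree_less n ((r - w) $ j)"
      using degree_less_step n by fastforce
  qed
  have "ip (shear A r - shear A w) (shear A (r - w)) = 0"
    using orth[OF low] target_row_orthogonal[OF n low, of A \<beta> \<gamma>] w(1) by (simp add: ip_diff_left)
  then have "shear A r - shear A w = 0"
    by (intro ip_definite) (simp add: shear_diff)
  then show ?thesis using w(1) by simp
qed

end

section \<open>From functionals to matrices and integrals\<close>

text \<open>The kernel is trivial: pairing the image of v with v gives |v|^2 + c |A v|^2.\<close>

lemma invertible_one_plus_gram:
  fixes A :: "real ^ 'q ^ 'q"
  assumes "0 \<le> c"
  shows "invertible (mat 1 + c *\<^sub>R (transpose A ** A))"
  unfolding invertible_left_inverse matrix_left_invertible_ker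
proof (intro allI impI)
  fix v :: "real ^ 'q"
  assume "(mat 1 + c *\<^sub>R (transpose A ** A)) *v v = 0"
  then have "v + c *\<^sub>R (transpose A *v (A *v v)) = 0"
    by (simp add: matrix_vector_mult_add_rdistrib scaleR_matrix_vector_assoc[symmetric] matrix_vector_mul_assoc)
  then have "v \<bullet> (v + c *\<^sub>R (transpose A *v (A *v v))) = 0" by simp
  then have "v \<bullet> v + c * ((A *v v) \<bullet> (A *v v)) = 0"
    by (metis dot_lmul_matrix inner_add_right inner_scaleR_right vector_transpose_matrix)
  moreover have "0 \<le> c * ((A *v v) \<bullet> (A *v v))" using assms by simp
  ultimately show "v = 0"
    by (smt (verit) inner_ge_zero inner_eq_zero_iff)
qed

lemma matrix_inv_left_mult:
  "invertible B \<Longrightarrow> matrix_inv B ** B = mat 1"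
  unfolding invertible_def matrix_inv_def by (rule someI2_ex) auto

lemma integrable_poly:
  assumes "borel_with_moments M"
  shows "integrable M (poly f)"
  using assms unfolding borel_with_moments_def poly_altdef by auto

lemma positive_functional_integral:
  assumes "borel_with_moments M"
  shows "positive_functional (\<lambda>f. \<integral>x. poly f x \<partial>M)"
  by unfold_locales (simp_all add: integrable_poly[OF assms])

text \<open>Expanding f in elementary matrices turns integrability of the entries into integrability
  of f; taking an entry is bounded linear and then commutes with the integral.\<close>

lemma integral_matrix_nth:
  fixes f :: "real \<Rightarrow> real ^ 'n ^ 'm"
  assumes "\<And>i j. integrable M (\<lambda>x. f x $ i $ j)"
  shows "(\<integral>x. f x \<partial>M) $ i $ j = (\<integral>x. f x $ i $ j \<partial>M)"
proof -
  have "(\<Sum>b\<in>UNIV. if i = a then if k = b then g b else 0 else 0) = (if i = a then g k else 0)"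
    for i a :: 'm and k :: 'n and g :: "'n \<Rightarrow> real"
    by simp
  then have "f = (\<lambda>x. \<Sum>i\<in>UNIV. \<Sum>j\<in>UNIV. f x $ i $ j *\<^sub>R axis i (axis j 1))"
    by (simp add: fun_eq_iff vec_eq_iff axis_def if_distrib[where f = "\<lambda>y. y $ _"]
        if_distrib[where f = "\<lambda>y. _ * y"] cong: if_cong)
  moreover have "integrable M (\<lambda>x. \<Sum>i\<in>UNIV. \<Sum>j\<in>UNIV. f x $ i $ j *\<^sub>R (axis i (axis j 1) :: real ^ 'n ^ 'm))"
    using assms by (intro Bochner_Integration.integrable_sum integrable_scaleR_left) auto
  ultimately have "integrable M f" by simp
  moreover have "bounded_linear (\<lambda>B :: real ^ 'n ^ 'm. B $ i $ j)"
    by (intro bounded_linear_compose[OF bounded_linear_vec_nth] bounded_linear_vec_nth)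
  ultimately show ?thesis
    using integral_bounded_linear by fastforce
qed

theorem proposition27:
  fixes M :: "real measure"
    and p :: "int \<Rightarrow> real poly"
    and J :: "int \<Rightarrow> int \<Rightarrow> real"
    and A :: "real ^ 'q ^ 'q"
    and P :: "int \<Rightarrow> real poly ^ ('q + 'q) ^ ('q + 'q)"
  assumes "borel_with_moments M"
    and "monic_orthogonal_polys M p"
    and "three_term_recurrence p J"
    and "monic_matrix_orthogonal_polys M (weight A) P"
  shows "(\<forall>k\<ge>-1. invertible (mat 1 + J (k + 1) k *\<^sub>R (transpose A ** A))) \<and>
    (\<forall>k\<ge>-1. \<forall>x. eval_mat (P (k + 1)) x ** weight_factor A x =
      - (poly (p k) x *\<^sub>R
          block ((J (k + 1) k * J (k + 1) (k + 1)) *\<^sub>R (A ** rho J A (k + 1) ** transpose A)) 0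
                (J (k + 1) k *\<^sub>R (rho J A (k + 1) ** transpose A)) 0)
      + poly (p (k + 1)) x *\<^sub>R
          block (mat 1) (J (k + 1) (k + 1) *\<^sub>R (A ** rho J A (k + 1)))
                0 (rho J A (k + 1))
      + poly (p (k + 2)) x *\<^sub>R block 0 A 0 0)"
proof -
  define L where "L f = (\<integral>x. poly f x \<partial>M)" for f
  interpret positive_functional L
    unfolding L_def by (rule positive_functional_integral[OF assms(1)])
  obtain h where h: "\<And>k. 0 \<le> k \<Longrightarrow> h k \<noteq> 0"
    "\<And>k j. 0 \<le> k \<Longrightarrow> 0 \<le> j \<Longrightarrow>
      (\<integral>x. poly (p k) x * poly (p j) x \<partial>M) = (if k = j then h k else 0)"
    using assms(2) unfolding monic_orthogonal_polys_def by metis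
  interpret orthogonal_sequence L p h J
  proof
    show "p (-1) = 0" "J 0 (-1) = 0"
      using assms(2,3) by (simp_all add: monic_orthogonal_polys_def three_term_recurrence_def)
    fix k :: int assume k: "0 \<le> k"
    then have deg: "degree (p k) = nat k" "lead_coeff (p k) = 1"
      using assms(2) unfolding monic_orthogonal_polys_def by blast+
    show "degree_less (k + 1) (p k)"
      using deg k by (auto simp: degree_less_def intro!: coeff_eq_0)
    show "coeff (p k) (nat k) = 1"
      using deg by simp
    show "h k \<noteq> 0" by (rule h(1)[OF k])
    show "L (p k * p j) = (if k = j then h k else 0)" if "0 \<le> j" for j
      using h(2)[OF k that] by (simp add: L_def)
    show "[:0, 1:] * p k = smult (J k (k - 1)) (p (k - 1)) + smult (J k k) (p k) + p (k + 1)"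
      using assms(3) k unfolding three_term_recurrence_def by blast
  qed
  have monic: "monic_of_degree (nat k) (P k)" if "0 \<le> k" for k
    using assms(4) that by (simp add: monic_matrix_orthogonal_polys_def)
  \<comment> \<open>Entry (i, l) of the matrix integrand is the dot product of sheared rows i and l,
    so the vanishing matrix integral gives the row orthogonality.\<close>
  have orth: "ip (shear A (P k $ i)) (shear A (P j $ l)) = 0"
    if kj: "0 \<le> k" "0 \<le> j" "k \<noteq> j" for k j i l
  proof -
    define F where "F x = eval_mat (P k) x ** weight A x ** transpose (eval_mat (P j) x)" for x
    have F: "F x $ i $ l = poly (\<Sum>m\<in>UNIV. shear A (P k $ i) $ m * shear A (P j $ l) $ m) x" for x i l
    proof -
      have "F x = (eval_mat (P k) x ** weight_factor A x) ** transpose (eval_mat (P j) x ** weight_factor A x)"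
        by (simp add: F_def weight_def matrix_transpose_mul matrix_mul_assoc)
      moreover have "(X ** transpose Y) $ i $ l = (\<Sum>m\<in>UNIV. X $ i $ m * Y $ l $ m)"
        for X Y :: "real ^ ('q + 'q) ^ ('q + 'q)"
        by (simp add: matrix_matrix_mult_def transpose_def)
      ultimately show ?thesis
        by (simp only: poly_shear poly_sum poly_mult)
    qed
    have "(\<integral>x. F x \<partial>M) = 0"
      using assms(4) kj unfolding monic_matrix_orthogonal_polys_def F_def by fastforce
    then have "(\<integral>x. F x $ i $ l \<partial>M) = 0"
      using integral_matrix_nth[of M F i l] integrable_poly[OF assms(1)] by (simp add: F)
    then have "L (\<Sum>m\<in>UNIV. shear A (P k $ i) $ m * shear A (P j $ l) $ m) = 0"
      by (simp only: F L_def)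
    then show ?thesis by (simp add: ip_def sum)
  qed
  have inv: "invertible (mat 1 + J n (n - 1) *\<^sub>R (transpose A ** A))" if "0 \<le> n" for n
    by (rule invertible_one_plus_gram[OF J_subdiagonal_nonneg[OF that]])
  \<comment> \<open>Here \<beta> and \<epsilon> are the two halves of row i of the identity, the
    leading coefficient of P_n, and \<gamma> has to solve the linear equation.\<close>
  have rows: "shear A (P n $ i) = target_row A n \<beta> \<gamma>"
    if n: "0 \<le> n"
      and "\<gamma> v* (mat 1 + J n (n - 1) *\<^sub>R (transpose A ** A)) = J n n *\<^sub>R (\<beta> v* A) + \<epsilon>"
      and "\<And>b. (mat 1 :: real ^ ('q + 'q) ^ ('q + 'q)) $ i $ Inl b = \<beta> $ b"
      and "\<And>b. (mat 1 :: real ^ ('q + 'q) ^ ('q + 'q)) $ i $ Inr b = \<epsilon> $ b" for n i \<beta> \<gamma> \<epsilon>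
  proof (rule shear_eq_target_row[OF n that(2)])
    have c: "coeff (P n $ i $ j) (nat n) = mat 1 $ i $ j" for j
      using monic[OF n] by (simp add: monic_of_degree_def coeff_mat_def vec_eq_iff)
    show "coeff (P n $ i $ Inl b) (nat n) = \<beta> $ b" "coeff (P n $ i $ Inr b) (nat n) = \<epsilon> $ b" for b
      by (simp_all only: c that)
    show "row_degree_less (n + 1) (P n $ i)"
      using monic[OF n] n
      by (auto simp: row_degree_less_def degree_less_def monic_of_degree_def coeff_mat_def vec_eq_iff)
    show "ip (shear A (P n $ i)) (shear A v) = 0" if "row_degree_less n v" for v
      using matrix_orthogonal_degree_less[OF monic orth that n] by blast
  qed
  \<comment> \<open>The asserted identity with n = k + 1, so that k >= -1 becomes n >= 0.\<close>
  have main: "eval_mat (P n) x ** weight_factor A x =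
      - (poly (p (n - 1)) x *\<^sub>R
          block ((J n (n - 1) * J n n) *\<^sub>R (A ** rho J A n ** transpose A)) 0
                (J n (n - 1) *\<^sub>R (rho J A n ** transpose A)) 0)
      + poly (p n) x *\<^sub>R block (mat 1) (J n n *\<^sub>R (A ** rho J A n)) 0 (rho J A n)
      + poly (p (n + 1)) x *\<^sub>R block 0 A 0 0" if n: "0 \<le> n" for n x
  proof -
    let ?R = "rho J A n" and ?G = "mat 1 + J n (n - 1) *\<^sub>R (transpose A ** A)"
    have RG: "?R ** ?G = mat 1"
      unfolding rho_def by (rule matrix_inv_left_mult[OF inv[OF n]])
    have row_mult: "(B $ a) v* C = (B ** C) $ a" for B C :: "real ^ 'q ^ 'q" and a
      by (simp add: vec_eq_iff vector_matrix_mult_def matrix_matrix_mult_def mult.commute)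
    have row_scale: "(c *\<^sub>R v) v* C = c *\<^sub>R (v v* C)" for c v and C :: "real ^ 'q ^ 'q"
      by (simp add: vec_eq_iff vector_matrix_mult_def sum_distrib_left mult_ac)
    \<comment> \<open>With \<beta> = e_a and \<epsilon> = 0 the equation reads \<gamma> G = J_{n,n}
      e_a A, where G is \<open>?G\<close>; multiplying by \<open>?R\<close> yields \<gamma>.\<close>
    have top: "shear A (P n $ Inl a) = target_row A n (mat 1 $ a) (J n n *\<^sub>R (A ** ?R) $ a)" for a
      by (rule rows[OF n, of _ _ 0])
         (simp_all add: row_scale row_mult RG flip: matrix_mul_assoc, simp_all add: mat_def)
    \<comment> \<open>With \<beta> = 0 and \<epsilon> = e_a the equation becomes \<gamma> G = e_a,
      solved by row a of \<open>?R\<close>.\<close>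
    have bot: "shear A (P n $ Inr a) = target_row A n 0 (?R $ a)" for a
      by (rule rows[OF n, of _ _ "mat 1 $ a"])
         (simp_all add: row_mult RG, simp_all add: mat_def)
    show ?thesis
      unfolding vec_eq_iff
    proof (intro allI)
      fix i j :: "'q + 'q"
      show "(eval_mat (P n) x ** weight_factor A x) $ i $ j = (- (poly (p (n - 1)) x *\<^sub>R
          block ((J n (n - 1) * J n n) *\<^sub>R (A ** rho J A n ** transpose A)) 0
                (J n (n - 1) *\<^sub>R (rho J A n ** transpose A)) 0)
          + poly (p n) x *\<^sub>R block (mat 1) (J n n *\<^sub>R (A ** rho J A n)) 0 (rho J A n)
          + poly (p (n + 1)) x *\<^sub>R block 0 A 0 0) $ i $ j"
        unfolding poly_shear
        \<comment> \<open>In the top rows \<gamma> A^T is a row of J_{n,n} A \<rho> A^T and \<beta>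
          A a row of A; in the bottom rows they are a row of \<rho> A^T and 0. These fill the blocks
          at p_{n-1} and p_{n+1}.\<close>
        by (cases i; cases j)
           (simp_all add: top bot target_row_def block_def row_scale row_mult
             del: shear_Inl shear_Inr vector_transpose_matrix)
    qed
  qed
  show ?thesis
    using inv[of "k + 1" for k] main[of "k + 1" for k] by (simp add: add.assoc)
qed

end
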